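(* Let $p\ge 2$, $d\ge 1$ and $n_1,\dots,n_p\ge 1$ be integers, and let $\mathbf e_k,\mathbf f_k,\mathbf g_{k,i},\mathbf h_{k,i}\in\mathbb R^{n_k}$ be arbitrary vectors for $k=1,\dots,p$ and $i=1,\dots,d$. Define $\mathbf T\in\mathbb R^{n_1\times\cdots\times n_p}$ by $$\mathbf T=\sum_{k=1}^{p}\big(\mathbf e_1\otimes\cdots\otimes\mathbf f_k\otimes\cdots\otimes\mathbf e_p\big)+\sum_{k_1=1}^{p-1}\sum_{k_2=k_1+1}^{p}\sum_{i=1}^{d}\big(\mathbf e_1\otimes\cdots\otimes\mathbf g_{k_1,i}\otimes\cdots\otimes\mathbf h_{k_2,i}\otimes\cdots\otimes\mathbf e_p\big),$$ where in the $k$-th term of the first sum the factor in position $k$ is $\mathbf f_k$, in the $(k_1,k_2,i)$ term of the second sum the factors in positions $k_1,k_2$ are $\mathbf g_{k_1,i},\mathbf h_{k_2,i}$, and in every other position $j$ the factor is $\mathbf e_j$. Then $\mathbf T$ can be written as a tensor train $\mathbf T=[\![\mathbf T^{(1)}]\!]\otimes\cdots\otimes[\![\mathbf T^{(p)}]\!]$ with all ranks $r_1,\dots,r_{p-1}$ equal to $d+2$ (and $r_0=r_p=1$) and cores $$[\![\mathbf T^{(1)}]\!]=\begin{bmatrix}\mathbf e_1&\mathbf f_1&\mathbf g_{1,1}&\cdots&\mathbf g_{1,d}\end{bmatrix},$$ $$[\![\mathbf T^{(k)}]\!]=\begin{bmatrix}\mathbf e_k&\mathbf f_k&\mathbf g_{k,1}&\cdots&\mathbf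 g_{k,d}\\0&\mathbf e_k&0&\cdots&0\\0&\mathbf h_{k,1}&\mathbf e_k&&0\\\vdots&\vdots&&\ddots&\\0&\mathbf h_{k,d}&0&&\mathbf e_k\end{bmatrix}\quad(2\le k\le p-1),$$ $$[\![\mathbf T^{(p)}]\!]=\begin{bmatrix}\mathbf f_p&\mathbf e_p&\mathbf h_{p,1}&\cdots&\mathbf h_{p,d}\end{bmatrix}^T .$$
   Context: Tensors are multi-dimensional real arrays. The tensor product of vectors $v^{(k)}\in\mathbb R^{n_k}$ is $(v^{(1)}\otimes\cdots\otimes v^{(p)})_{u_1,\dots,u_p}=\prod_{k=1}^p v^{(k)}_{u_k}$. Tensor train (TT) format: given cores $\mathbf T^{(k)}\in\mathbb R^{r_{k-1}\times n_k\times r_k}$, $k=1,\dots,p$, with $r_0=r_p=1$, the associated tensor is $$\mathbf T=\sum_{s_0=1}^{r_0}\cdots\sum_{s_p=1}^{r_p}\mathbf T^{(1)}_{s_0,:,s_1}\otimes\cdots\otimes\mathbf T^{(p)}_{s_{p-1},:,s_p}.$$ The $r_k$ are the TT ranks (here "ranks" means the sizes of the cores of the representation, not minimal ranks). Rank-core notation: $[\![\mathbf T^{(k)}]\!]$ is the $r_{k-1}\times r_k$ matrix whose $(s,t)$ entry is the vector $\mathbf T^{(k)}_{s,:,t}\in\mathbb R^{n_k}$; $[\![\mathbf T^{(1)}]\!]\otimes\cdots\otimes[\![\mathbf T^{(p)}]\!]$ is the formal matrix product in which entries are multiplied by $\otimes$, and it equals the sum above. An entry $0$ is the zero vector. The transpose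 of a row of vectors is the corresponding column of vectors. *)

theory Defs
  imports "Jordan_Normal_Form.Matrix" "HOL-Library.FuncSet"
begin

text \<open>Modes \<open>k\<close> and summation indices \<open>i\<close> are numbered from 1; entries of vectors and matrices are
  numbered from 0, as in \<^theory>\<open>Jordan_Normal_Form.Matrix\<close>.

  A tensor of shape \<open>n 1 \<times> \<dots> \<times> n p\<close> is a function on the multi-indices \<open>u\<close> with \<open>u k < n k\<close> for
  \<open>k \<in> {1..p}\<close>, extended by 0 to all other arguments. With this convention equality of tensors of
  the same shape is equality of functions, and sums of tensors are pointwise.\<close>

type_synonym tensor = "(nat \<Rightarrow> nat) \<Rightarrow> real"

definition multi_indices :: "nat \<Rightarrow> (nat \<Rightarrow> nat) \<Rightarrow> (nat \<Rightarrow> nat) set" where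
  "multi_indices p n = (\<Pi>\<^sub>E k\<in>{1..p}. {..<n k})"

definition tensor_prod :: "nat \<Rightarrow> (nat \<Rightarrow> real vec) \<Rightarrow> tensor" where
  "tensor_prod p v =
    (\<lambda>u. if u \<in> multi_indices p (\<lambda>k. dim_vec (v k)) then \<Prod>k=1..p. v k $ u k else 0)"

text \<open>The core \<open>G k\<close> is given in rank-core form: the entry \<open>(s, t)\<close> of the matrix \<open>G k\<close> is the
  vector \<open>G k\<^bsub>s,:,t\<^esub>\<close>. The index \<open>s\<close> runs over all tuples \<open>(s 0, \<dots>, s p)\<close> with \<open>s k < r k\<close>.\<close>

definition tt_tensor :: "nat \<Rightarrow> (nat \<Rightarrow> nat) \<Rightarrow> (nat \<Rightarrow> real vec mat) \<Rightarrow> tensor" where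
  "tt_tensor p r G =
    (\<lambda>u. \<Sum>s \<in> (\<Pi>\<^sub>E k\<in>{0..p}. {..<r k}). tensor_prod p (\<lambda>k. G k $$ (s (k - 1), s k)) u)"

definition is_tensor_train ::
  "nat \<Rightarrow> (nat \<Rightarrow> nat) \<Rightarrow> (nat \<Rightarrow> nat) \<Rightarrow> (nat \<Rightarrow> real vec mat) \<Rightarrow> tensor \<Rightarrow> bool" where
  "is_tensor_train p n r G T \<longleftrightarrow>
    r 0 = 1 \<and> r p = 1 \<and>
    (\<forall>k\<in>{1..p}. G k \<in> carrier_mat (r (k - 1)) (r k) \<and> elements_mat (G k) \<subseteq> carrier_vec (n k)) \<and>
    T = tt_tensor p r G"

definition pairwise_sum_tensor ::
  "nat \<Rightarrow> nat \<Rightarrow> (nat \<Rightarrow> real vec) \<Rightarrow> (nat \<Rightarrow> real vec) \<Rightarrow>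
    (nat \<Rightarrow> nat \<Rightarrow> real vec) \<Rightarrow> (nat \<Rightarrow> nat \<Rightarrow> real vec) \<Rightarrow> tensor" where
  "pairwise_sum_tensor p d e f g h =
    (\<lambda>u. (\<Sum>k=1..p. tensor_prod p (e(k := f k)) u) +
         (\<Sum>k1=1..p-1. \<Sum>k2=k1+1..p. \<Sum>i=1..d.
            tensor_prod p (e(k1 := g k1 i, k2 := h k2 i)) u))"

definition pairwise_sum_core ::
  "nat \<Rightarrow> nat \<Rightarrow> (nat \<Rightarrow> nat) \<Rightarrow> (nat \<Rightarrow> real vec) \<Rightarrow> (nat \<Rightarrow> real vec) \<Rightarrow>
    (nat \<Rightarrow> nat \<Rightarrow> real vec) \<Rightarrow> (nat \<Rightarrow> nat \<Rightarrow> real vec) \<Rightarrow> nat \<Rightarrow> real vec mat" where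
  "pairwise_sum_core p d n e f g h k =
    (if k = 1 then
       mat_of_rows_list (d + 2) [[e k, f k] @ map (\<lambda>i. g k i) [1..<d+1]]
     else if k = p then
       transpose_mat (mat_of_rows_list (d + 2) [[f k, e k] @ map (\<lambda>i. h k i) [1..<d+1]])
     else
       mat_of_rows_list (d + 2)
         ([[e k, f k] @ map (\<lambda>i. g k i) [1..<d+1],
           [0\<^sub>v (n k), e k] @ map (\<lambda>i. 0\<^sub>v (n k)) [1..<d+1]] @
          map (\<lambda>i. [0\<^sub>v (n k), h k i] @ map (\<lambda>j. if j = i then e k else 0\<^sub>v (n k)) [1..<d+1])
            [1..<d+1]))"

end

theory Submission
  imports Defs
begin

text \<open>At a fixed multi-index the rank cores become real matrices, and their product is evaluated
  from left to right. The product of the first \<open>m < p\<close> cores is the row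
  \<open>[E m, S m, L 1 m, \<dots>, L d m]\<close>, where \<open>E m\<close> is the product of the first \<open>m\<close> factors \<open>e\<close>, \<open>S m\<close> is
  the given sum truncated to the first \<open>m\<close> modes, and \<open>L i m\<close> collects the terms in which exactly
  one of the first \<open>m\<close> factors is replaced, by \<open>g k i\<close>, and its partner \<open>h\<close> is still to come.
  Multiplication by the next core is the recursion for these sums in \<open>m\<close>.\<close>

section \<open>Sums over index tuples\<close>

text \<open>Entry \<open>t\<close> of the row obtained by multiplying an all-ones row over
  \<open>A 0\<close> by the matrices \<open>c 1\<close>, ..., \<open>c m\<close> in turn. If
  \<open>A 0\<close> is a singleton, this is row 0 of the plain matrix product for
  \<open>m > 0\<close>.\<close>

fun partial_product :: "(nat \<Rightarrow> 'b set) \<Rightarrow> (nat \<Rightarrow> 'b \<Rightarrow> 'b \<Rightarrow> 'a :: comm_semiring_1) \<Rightarrow> nat \<Rightarrow> 'b \<Rightarrow> 'a"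
where
  "partial_product A c 0 t = 1"
| "partial_product A c (Suc m) t = (\<Sum>s\<in>A m. partial_product A c m s * c (Suc m) s t)"

lemma sum_PiE_insert:
  assumes "i \<notin> I"
  shows "(\<Sum>s\<in>PiE (insert i I) A. F s) = (\<Sum>t\<in>A i. \<Sum>s\<in>PiE I A. F (s(i := t)))"
proof -
  have "(\<Sum>s\<in>PiE (insert i I) A. F s) = (\<Sum>(t, s)\<in>A i \<times> PiE I A. F (s(i := t)))"
    unfolding PiE_insert_eq
    by (subst sum.reindex[OF inj_combinator[OF assms]]) (simp add: case_prod_unfold)
  then show ?thesis
    by (simp add: sum.cartesian_product)
qed

text \<open>Distributivity, by induction on the number of factors. The weight \<open>\<phi>\<close>
  of the last index stays arbitrary so that, for a fixed new index, the new factor can be absorbed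
  into it.\<close>

lemma sum_PiE_path_product:
  "(\<Sum>s\<in>PiE {0..m} A. (\<Prod>k=1..m. c k (s (k - 1)) (s k)) * \<phi> (s m)) =
    (\<Sum>t\<in>A m. partial_product A c m t * \<phi> t)"
proof (induction m arbitrary: \<phi>)
  case 0
  show ?case
    using sum_PiE_insert[of 0 "{}" "\<lambda>s. \<phi> (s 0)" A] by simp
next
  case (Suc m)
  have ins: "{0..Suc m} = insert (Suc m) {0..m}" by auto
  have upd: "(\<Prod>k=1..Suc m. c k ((s(Suc m := t)) (k - 1)) ((s(Suc m := t)) k)) =
      (\<Prod>k=1..m. c k (s (k - 1)) (s k)) * c (Suc m) (s m) t" for s t
  proof -
    have "(\<Prod>k=1..m. c k ((s(Suc m := t)) (k - 1)) ((s(Suc m := t)) k)) =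
        (\<Prod>k=1..m. c k (s (k - 1)) (s k))"
      by (rule prod.cong) auto
    then show ?thesis by simp
  qed
  have "(\<Sum>s\<in>PiE {0..Suc m} A. (\<Prod>k=1..Suc m. c k (s (k - 1)) (s k)) * \<phi> (s (Suc m))) =
      (\<Sum>t\<in>A (Suc m). \<Sum>s\<in>PiE {0..m} A.
        (\<Prod>k=1..m. c k (s (k - 1)) (s k)) * (c (Suc m) (s m) t * \<phi> t))"
    unfolding ins by (subst sum_PiE_insert) (simp_all only: upd fun_upd_same mult.assoc, auto)
  also have "\<dots> = (\<Sum>t\<in>A (Suc m). \<Sum>s\<in>A m. partial_product A c m s * (c (Suc m) s t * \<phi> t))"
    using Suc.IH[of "\<lambda>s. c (Suc m) s t * \<phi> t" for t] by simp
  finally show ?case by (simp add: sum_distrib_right mult.assoc)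
qed

section \<open>Products with one or two factors replaced\<close>

definition single_sum :: "(nat \<Rightarrow> 'a :: comm_semiring_1) \<Rightarrow> (nat \<Rightarrow> 'a) \<Rightarrow> nat \<Rightarrow> 'a" where
  "single_sum e v m = (\<Sum>k=1..m. \<Prod>j=1..m. (e(k := v k)) j)"

text \<open>\<open>k1\<close> runs up to \<open>m\<close> rather than \<open>m - 1\<close>: the term
  \<open>k1 = m\<close> has an empty inner sum, and the recursion in \<open>m\<close> stays free of
  subtraction.\<close>

definition double_sum ::
  "(nat \<Rightarrow> 'a :: comm_semiring_1) \<Rightarrow> (nat \<Rightarrow> 'a) \<Rightarrow> (nat \<Rightarrow> 'a) \<Rightarrow> nat \<Rightarrow> 'a" where
  "double_sum e v w m =
    (\<Sum>k1=1..m. \<Sum>k2=k1+1..m. \<Prod>j=1..m. (e(k1 := v k1, k2 := w k2)) j)"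

lemma prod_upd_last:
  "(\<Prod>j=1..Suc m. (e(Suc m := x)) j) = (\<Prod>j=1..m. e j) * (x :: 'a :: comm_semiring_1)"
proof -
  have "(\<Prod>j=1..m. (e(Suc m := x)) j) = (\<Prod>j=1..m. e j)"
    by (rule prod.cong) auto
  then show ?thesis by simp
qed

text \<open>Either the replaced position is at most \<open>m\<close>, and \<open>e (Suc m)\<close>
  factors out, or it is \<open>Suc m\<close>.\<close>

lemma single_sum_Suc:
  "single_sum e v (Suc m) = single_sum e v m * e (Suc m) + (\<Prod>j=1..m. e j) * v (Suc m)"
proof -
  have "(\<Sum>k=1..m. \<Prod>j=1..Suc m. (e(k := v k)) j) =
      (\<Sum>k=1..m. (\<Prod>j=1..m. (e(k := v k)) j) * e (Suc m))"
    by (rule sum.cong) auto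
  then show ?thesis
    unfolding single_sum_def by (simp add: sum_distrib_right prod_upd_last
        del: fun_upd_apply prod.cl_ivl_Suc One_nat_def)
qed

text \<open>The case distinction is on the later position \<open>k2\<close>. If
  \<open>k2 = Suc m\<close>, one replacement, at \<open>k1\<close>, remains among the first
  \<open>m\<close> factors.\<close>

lemma double_sum_Suc:
  "double_sum e v w (Suc m) = double_sum e v w m * e (Suc m) + single_sum e v m * w (Suc m)"
proof -
  have "(\<Sum>k2=k1+1..Suc m. \<Prod>j=1..Suc m. (e(k1 := v k1, k2 := w k2)) j) =
      (\<Sum>k2=k1+1..m. \<Prod>j=1..m. (e(k1 := v k1, k2 := w k2)) j) * e (Suc m) +
      (\<Prod>j=1..m. (e(k1 := v k1)) j) * w (Suc m)" if "k1 \<in> {1..m}" for k1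
  proof -
    have "(\<Sum>k2=k1+1..m. \<Prod>j=1..Suc m. (e(k1 := v k1, k2 := w k2)) j) =
        (\<Sum>k2=k1+1..m. \<Prod>j=1..m. (e(k1 := v k1, k2 := w k2)) j) * e (Suc m)"
      unfolding sum_distrib_right using that by (intro sum.cong) auto
    then show ?thesis
      using that prod_upd_last[where m = m and e = "e(k1 := v k1)" and x = "w (Suc m)"]
      by (simp add: del: fun_upd_apply prod.cl_ivl_Suc One_nat_def)
  qed
  then have "double_sum e v w (Suc m) = (\<Sum>k1=1..m.
      (\<Sum>k2=k1+1..m. \<Prod>j=1..m. (e(k1 := v k1, k2 := w k2)) j) * e (Suc m) +
      (\<Prod>j=1..m. (e(k1 := v k1)) j) * w (Suc m))"
    unfolding double_sum_def by (simp del: fun_upd_apply prod.cl_ivl_Suc One_nat_def)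
  then show ?thesis
    by (simp add: double_sum_def single_sum_def sum.distrib sum_distrib_right)
qed

section \<open>Entries of the cores\<close>

lemma nth_map_from_1: "i < d \<Longrightarrow> map F [1..<d+1] ! i = F (i + 1)"
  by (simp del: upt_Suc)

text \<open>Positions 0 and 1 are taken by \<open>e\<close> and \<open>f\<close>, so position
  \<open>t \<ge> 2\<close> belongs to the summation index \<open>t - 1\<close>.\<close>

lemma pairwise_sum_core_first:
  shows "pairwise_sum_core p d n e f g h 1 \<in> carrier_mat 1 (d + 2)"
    and "t < d + 2 \<Longrightarrow> pairwise_sum_core p d n e f g h 1 $$ (0, t) =
      (if t = 0 then e 1 else if t = 1 then f 1 else g 1 (t - 1))"
  by (auto simp: pairwise_sum_core_def mat_of_rows_list_def nth_Cons' nth_map_from_1 Suc_diff_Suc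
      simp del: upt_Suc)

lemma pairwise_sum_core_last:
  assumes "p \<noteq> 1"
  shows "pairwise_sum_core p d n e f g h p \<in> carrier_mat (d + 2) 1"
    and "s < d + 2 \<Longrightarrow> pairwise_sum_core p d n e f g h p $$ (s, 0) =
      (if s = 0 then f p else if s = 1 then e p else h p (s - 1))"
  using assms by (auto simp: pairwise_sum_core_def mat_of_rows_list_def nth_Cons' nth_map_from_1 Suc_diff_Suc
      simp del: upt_Suc)

lemma pairwise_sum_core_middle:
  assumes "k \<noteq> 1" and "k \<noteq> p"
  shows "pairwise_sum_core p d n e f g h k \<in> carrier_mat (d + 2) (d + 2)"
    and "s < d + 2 \<Longrightarrow> t < d + 2 \<Longrightarrow> pairwise_sum_core p d n e f g h k $$ (s, t) =
      (if s = 0 then (if t = 0 then e k else if t = 1 then f k else g k (t - 1))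
       else if s = t then e k
       else if s \<noteq> 1 \<and> t = 1 then h k (s - 1)
       else 0\<^sub>v (n k))"
  using assms by (auto simp: pairwise_sum_core_def mat_of_rows_list_def nth_Cons' nth_map_from_1 Suc_diff_Suc
      simp del: upt_Suc)

text \<open>Gives all products the common index set \<open>multi_indices p n\<close>, whereas the
  definition reads it off the dimensions of the factors.\<close>

lemma tensor_prod_eq:
  assumes "\<And>k. k \<in> {1..p} \<Longrightarrow> v k \<in> carrier_vec (n k)"
  shows "tensor_prod p v u = (if u \<in> multi_indices p n then \<Prod>k=1..p. v k $ u k else 0)"
proof -
  have "multi_indices p (\<lambda>k. dim_vec (v k)) = multi_indices p n"
    unfolding multi_indices_def using assms by (intro PiE_cong) auto
  then show ?thesis by (simp add: tensor_prod_def)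
qed

lemma sum_lessThan_add_2:
  "(\<Sum>s<d+2. F s) = F 0 + (F 1 + (\<Sum>i=1..d. F (Suc i)))" for F :: "nat \<Rightarrow> 'a :: comm_monoid_add"
proof -
  have "(\<Sum>i=1..d. F (Suc i)) = (\<Sum>i<d. F (Suc (Suc i)))"
    by (rule sum.reindex_bij_witness[of _ Suc "\<lambda>i. i - 1"]) auto
  then show ?thesis
    by (simp add: sum.lessThan_Suc_shift del: sum.lessThan_Suc)
qed

theorem proposition3p1:
  fixes p d :: nat and n :: "nat \<Rightarrow> nat"
    and e f :: "nat \<Rightarrow> real vec" and g h :: "nat \<Rightarrow> nat \<Rightarrow> real vec"
  assumes "p \<ge> 2" and "d \<ge> 1"
    and "\<And>k. k \<in> {1..p} \<Longrightarrow> n k \<ge> 1"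
    and "\<And>k. k \<in> {1..p} \<Longrightarrow> e k \<in> carrier_vec (n k)"
    and "\<And>k. k \<in> {1..p} \<Longrightarrow> f k \<in> carrier_vec (n k)"
    and "\<And>k i. k \<in> {1..p} \<Longrightarrow> i \<in> {1..d} \<Longrightarrow> g k i \<in> carrier_vec (n k)"
    and "\<And>k i. k \<in> {1..p} \<Longrightarrow> i \<in> {1..d} \<Longrightarrow> h k i \<in> carrier_vec (n k)"
  shows "is_tensor_train p n (\<lambda>k. if k = 0 \<or> k = p then 1 else d + 2)
           (pairwise_sum_core p d n e f g h) (pairwise_sum_tensor p d e f g h)"
proof -
  define r where "r = (\<lambda>k. if k = 0 \<or> k = p then 1 else d + 2)"
  define G where "G = pairwise_sum_core p d n e f g h"
  note first = pairwise_sum_core_first[where p = p and d = d and n = n and e = e and f = f and g = g and h = h, folded G_def]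
  note middle = pairwise_sum_core_middle[where p = p and d = d and n = n and e = e and f = f and g = g and h = h, folded G_def]
  have "p \<noteq> 1" using assms(1) by simp
  note last = pairwise_sum_core_last[OF this, where d = d and n = n and e = e and f = f and g = g and h = h, folded G_def]
  note carrier = assms(4-7)

  \<comment> \<open>Shapes of the cores and of their entries\<close>
  have G_carrier: "G k \<in> carrier_mat (r (k - 1)) (r k)" if "k \<in> {1..p}" for k
    using that assms(1) first(1) middle(1)[of k] last(1)
    by (cases "k = 1"; cases "k = p") (auto simp: r_def)
  have pred: "x - 1 \<in> {1..d}" if "x < d + 2" "x \<noteq> 0" "x \<noteq> 1" for x
    using that by auto
  have G_entry: "G k $$ (s, t) \<in> carrier_vec (n k)"
    if "k \<in> {1..p}" "s < r (k - 1)" "t < r k" for k s t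
  proof -
    consider "k = 1" | "k = p" "k \<noteq> 1" | "k \<noteq> 1" "k \<noteq> p" by blast
    then show ?thesis
    proof cases
      case 1
      then show ?thesis using that assms(1) first(2)[of t] carrier(1,2)[of 1]
        carrier(3)[OF _ pred, of 1 t]
        by (auto simp: r_def split: if_splits)
    next
      case 2
      then show ?thesis using that assms(1) last(2)[of s] carrier(1,2)[of p]
        carrier(4)[OF _ pred, of p s]
        by (auto simp: r_def split: if_splits)
    next
      case 3
      then show ?thesis using that assms(1) middle(2)[of k s t] carrier(1,2)[of k]
        carrier(3)[OF _ pred, of k t] carrier(4)[OF _ pred, of k s]
        by (auto simp: r_def split: if_splits)
    qed
  qed
  have G_elements: "elements_mat (G k) \<subseteq> carrier_vec (n k)" if "k \<in> {1..p}" for k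
    using G_carrier[OF that] G_entry[OF that] by (auto simp: elements_mat_def)

  \<comment> \<open>Equality of the two tensors at each multi-index\<close>
  have single: "tensor_prod p (e(k := f k)) u =
      (if u \<in> multi_indices p n then \<Prod>j=1..p. (e(k := f k)) j $ u j else 0)"
    if "k \<in> {1..p}" for k u
    using carrier that by (intro tensor_prod_eq) auto
  have double: "tensor_prod p (e(k1 := g k1 i, k2 := h k2 i)) u =
      (if u \<in> multi_indices p n then \<Prod>j=1..p. (e(k1 := g k1 i, k2 := h k2 i)) j $ u j else 0)"
    if "k1 \<in> {1..p}" "k2 \<in> {1..p}" "i \<in> {1..d}" for k1 k2 i u
    using carrier that by (intro tensor_prod_eq) auto

  have "pairwise_sum_tensor p d e f g h u = tt_tensor p r G u" for u
  proof (cases "u \<in> multi_indices p n")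
    \<comment> \<open>Outside the index set every summand on either side takes the default value
      0.\<close>
    case False
    have "tensor_prod p (\<lambda>k. G k $$ (s (k - 1), s k)) u = 0"
      if "s \<in> (\<Pi>\<^sub>E k\<in>{0..p}. {..<r k})" for s
      using that False by (subst tensor_prod_eq[of p _ n]) (auto intro!: G_entry simp: PiE_iff)
    then have "tt_tensor p r G u = 0" by (simp add: tt_tensor_def)
    moreover have "pairwise_sum_tensor p d e f g h u = 0"
      unfolding pairwise_sum_tensor_def using False
      by (auto simp: single double intro!: sum.neutral)
    ultimately show ?thesis by simp
  next
    case True
    define c where "c = (\<lambda>k s t. G k $$ (s, t) $ u k)"
    define E where "E = (\<lambda>k. e k $ u k)"
    define F where "F = (\<lambda>k. f k $ u k)"
    \<comment> \<open>The arguments of \<open>g\<close> and \<open>h\<close> are swapped so that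
      \<open>P i\<close> and \<open>Q i\<close> are sequences in the mode.\<close>
    define P where "P = (\<lambda>i k. g k i $ u k)"
    define Q where "Q = (\<lambda>i k. h k i $ u k)"
    define S where "S = (\<lambda>m. single_sum E F m + (\<Sum>i=1..d. double_sum E (P i) (Q i) m))"
    define W where "W = partial_product (\<lambda>k. {..<r k}) c"
    \<comment> \<open>Needed to evaluate the zero entries of the cores:
      \<open>0\<^sub>v (n k) $ u k\<close> is 0 only for an index in range.\<close>
    have u: "u k < n k" if "k \<in> {1..p}" for k
      using that True by (auto simp: multi_indices_def)
    have S_Suc: "S (Suc m) = S m * E (Suc m) + (\<Prod>j=1..m. E j) * F (Suc m) +
        (\<Sum>i=1..d. single_sum E (P i) m * Q i (Suc m))" for m
      by (simp add: S_def single_sum_Suc double_sum_Suc sum.distrib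
          sum_distrib_right distrib_right add_ac)

    \<comment> \<open>The factor 1 is the constant weight in
      \<open>sum_PiE_path_product\<close>.\<close>
    have "tt_tensor p r G u =
        (\<Sum>s\<in>PiE {0..p} (\<lambda>k. {..<r k}). (\<Prod>k=1..p. c k (s (k - 1)) (s k)) * 1)"
      unfolding tt_tensor_def
    proof (rule sum.cong)
      fix s assume "s \<in> PiE {0..p} (\<lambda>k. {..<r k})"
      then show "tensor_prod p (\<lambda>k. G k $$ (s (k - 1), s k)) u =
          (\<Prod>k=1..p. c k (s (k - 1)) (s k)) * 1"
        using True by (subst tensor_prod_eq[of p _ n]) (auto intro!: G_entry simp: PiE_iff c_def)
    qed simp
    also have "\<dots> = (\<Sum>t\<in>{..<r p}. W p t * 1)"
      unfolding W_def by (rule sum_PiE_path_product)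
    finally have tt: "tt_tensor p r G u = W p 0" by (simp add: r_def)

    have row: "W m 0 = (\<Prod>j=1..m. E j) \<and> W m 1 = S m \<and>
        (\<forall>i\<in>{1..d}. W m (Suc i) = single_sum E (P i) m)" if "1 \<le> m" "m < p" for m
      using that
    proof (induction m rule: nat_induct_at_least)
      case base
      \<comment> \<open>Since \<open>r 0 = 1\<close>, only the start index 0 contributes. Moreover
        \<open>S 1 = F 1\<close>, because no pair of positions fits into one mode.\<close>
      have "W 1 t = c 1 0 t" for t by (simp add: W_def r_def)
      then show ?case
        by (auto simp: c_def first(2)[unfolded One_nat_def] E_def F_def P_def S_def single_sum_def double_sum_def)
    next
      case (Suc m)
      define k where "k = Suc m"
      have k: "k \<in> {1..p}" "k \<noteq> 1" "k \<noteq> p" using Suc by (auto simp: k_def)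
      have rm: "r m = d + 2" using Suc by (auto simp: r_def)
      have step: "W (Suc m) t = W m 0 * c k 0 t + (W m 1 * c k 1 t +
          (\<Sum>i=1..d. W m (Suc i) * c k (Suc i) t))" for t
        by (simp only: W_def partial_product.simps rm sum_lessThan_add_2 k_def)
      have IH: "W m 0 = (\<Prod>j=1..m. E j)" "W m 1 = S m"
        "\<And>i. i \<in> {1..d} \<Longrightarrow> W m (Suc i) = single_sum E (P i) m"
        using Suc by auto
      note c = c_def middle(2)[OF k(2,3)] E_def F_def P_def Q_def u[OF k(1)]
      have c0: "c k 0 0 = E k" "c k 1 0 = 0" "\<And>i. i \<in> {1..d} \<Longrightarrow> c k (Suc i) 0 = 0"
        by (auto simp: c)
      have c1: "c k 0 1 = F k" "c k 1 1 = E k" "\<And>i. i \<in> {1..d} \<Longrightarrow> c k (Suc i) 1 = Q i k"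
        by (auto simp: c)
      have ci: "c k 0 (Suc i) = P i k" "c k 1 (Suc i) = 0"
        "\<And>j. j \<in> {1..d} \<Longrightarrow> c k (Suc j) (Suc i) = (if j = i then E k else 0)"
        if "i \<in> {1..d}" for i
        using that by (auto simp: c)
      have "W (Suc m) 0 = (\<Prod>j=1..Suc m. E j)"
        unfolding step IH(1,2) c0(1,2) using c0(3) by (simp add: k_def)
      moreover have "W (Suc m) 1 = S (Suc m)"
        unfolding step IH(1,2) c1(1,2) S_Suc using IH(3) c1(3) by (simp add: k_def)
      moreover have "W (Suc m) (Suc i) = single_sum E (P i) (Suc m)" if "i \<in> {1..d}" for i
      proof -
        \<comment> \<open>The lower right block of the core is diagonal, so a pending
          \<open>g\<close> with index \<open>i\<close> can only be carried on with the same
          \<open>i\<close>.\<close>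
        have "(\<Sum>j=1..d. W m (Suc j) * c k (Suc j) (Suc i)) =
            (\<Sum>j=1..d. if j = i then single_sum E (P i) m * E k else 0)"
          using IH(3) ci(3)[OF that] by (intro sum.cong) auto
        also have "\<dots> = single_sum E (P i) m * E k" using that by simp
        finally show ?thesis
          unfolding step IH(1,2) ci(1,2)[OF that] single_sum_Suc by (simp add: k_def)
      qed
      ultimately show ?case by blast
    qed

    obtain q where p: "p = Suc q" and q: "1 \<le> q" "q < p"
      using assms(1) by (cases p) auto
    have rq: "r q = d + 2" using q by (auto simp: r_def)
    \<comment> \<open>The last core has the form of column 1 of a middle core, with \<open>f\<close>
      above \<open>e\<close>. Hence the final multiplication is the recursion
      \<open>S_Suc\<close>.\<close>
    have cp: "c p 0 0 = F p" "c p 1 0 = E p" "\<And>i. i \<in> {1..d} \<Longrightarrow> c p (Suc i) 0 = Q i p"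
      by (auto simp: c_def last(2) E_def F_def Q_def)
    have "W p 0 = W q 0 * c p 0 0 + (W q 1 * c p 1 0 +
        (\<Sum>i=1..d. W q (Suc i) * c p (Suc i) 0))"
      by (simp only: W_def partial_product.simps rq sum_lessThan_add_2 p)
    also have "\<dots> = S p"
      using row[OF q] cp S_Suc[of q] by (simp add: p)
    finally have "tt_tensor p r G u = S p" using tt by simp

    moreover have "tensor_prod p (e(k := f k)) u = (\<Prod>j=1..p. (E(k := F k)) j)"
      if "k \<in> {1..p}" for k
      using single[OF that, of u] True by (auto simp: E_def F_def intro!: prod.cong)
    moreover have "tensor_prod p (e(k1 := g k1 i, k2 := h k2 i)) u =
        (\<Prod>j=1..p. (E(k1 := P i k1, k2 := Q i k2)) j)"
      if "k1 \<in> {1..p}" "k2 \<in> {1..p}" "i \<in> {1..d}" for k1 k2 i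
      using double[OF that, of u] True by (auto simp: E_def P_def Q_def intro!: prod.cong)
    \<comment> \<open>The upper bound \<open>p\<close> for \<open>k1\<close> drops to
      \<open>p - 1\<close> because the term \<open>k1 = p\<close> is empty; then the sum over
      \<open>i\<close> is moved innermost.\<close>
    moreover have "(\<Sum>i=1..d. double_sum E (P i) (Q i) p) =
        (\<Sum>k1=1..p-1. \<Sum>k2=k1+1..p. \<Sum>i=1..d.
          \<Prod>j=1..p. (E(k1 := P i k1, k2 := Q i k2)) j)"
    proof -
      have "double_sum E (P i) (Q i) p = (\<Sum>k1=1..p-1. \<Sum>k2=k1+1..p.
          \<Prod>j=1..p. (E(k1 := P i k1, k2 := Q i k2)) j)" for i
        unfolding double_sum_def by (simp add: p del: fun_upd_apply prod.cl_ivl_Suc One_nat_def)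
      then show ?thesis
        by (simp only: sum.swap[of _ _ "{1..d}"])
    qed
    ultimately show ?thesis
      unfolding pairwise_sum_tensor_def S_def single_sum_def
      by (simp del: fun_upd_apply)
  qed
  then show ?thesis
    unfolding is_tensor_train_def r_def[symmetric] G_def[symmetric]
    using G_carrier G_elements by (auto simp: r_def)
qed

end
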